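(* Let $(G,\omega,\mu)$ be an infinite, connected, locally finite weighted graph and let $\Omega\subset G$ be a nonempty finite subset. Suppose that for some $k_0>0$ $$0\le \mathfrak{D}_+(x)\le k_0\quad\text{for all }x\in G\text{ with }\rho(x,\Omega)\ge 1,$$ where $\mathfrak{D}_+$ is the outer degree with respect to $\Omega$. Let $V:G\to\mathbb{R}$ satisfy, for some $\alpha\in[0,1]$ and $c_0>0$, $$V(x)\ge c_0\,[1+\rho(x,\Omega)]^{-\alpha}\quad\text{for all }x\in G .$$ Let $u:G\to\mathbb{R}$ be a subsolution of $\Delta u-Vu=0$ in $G$ such that $$\limsup_{\rho(x,\Omega)\to+\infty}\frac{u(x)}{|\tilde Z(x)|}\le 0,$$ where, whenever $\rho(x,\Omega)>1$, $\tilde Z(x):=-[\rho(x,\Omega)]^{1-\alpha}$ if $\alpha\in[0,1)$ and $\tilde Z(x):=-\log\rho(x,\Omega)$ if $\alpha=1$. Then $u(x)\le 0$ for all $x\in G$.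
   Context: A weighted graph is a triplet $(G,\omega,\mu)$ where $G$ is a countably infinite set, $\mu:G\to(0,+\infty)$ is the node measure, and $\omega:G\times G\to[0,+\infty)$ is the edge weight, satisfying $\omega(x,y)=\omega(y,x)$, $\omega(x,x)=0$ and $\sum_{y\in G}\omega(x,y)<\infty$ for all $x,y\in G$. Write $x\sim y$ if $\omega(x,y)>0$. A path is a finite sequence $x_0,\dots,x_n$ with $x_k\sim x_{k+1}$ for all $k$. The graph is connected if any two distinct vertices are joined by a path, and locally finite if every $x\in G$ has only finitely many $y$ with $x\sim y$. The combinatorial distance $\rho(x,y)$ is the least number of edges in a path between $x$ and $y$; $\rho(x,\Omega)=\min_{y\in\Omega}\rho(x,y)$; $S_r(\Omega)=\{x\in G:\rho(x,\Omega)=r\}$ for integers $r\ge0$. For $x\in G$ with $r=\rho(x,\Omega)\ge1$, the outer degree with respect to $\Omega$ is $\mathfrak{D}_+(x)=\frac1{\mu(x)}\sum_{y\in S_{r+1}(\Omega)}\omega(x,y)$. The Laplace operator is $\Delta f(x)=\frac1{\mu(x)}\sum_{y\in G}[f(y)-f(x)]\,\omega(x,y)$ for $f:G\to\mathbb{R}$, $x\in G$. A function $u:G\to\mathbb{R}$ is a subsolution of $\Delta u-Vu=0$ in $G$ if $\Delta u(x)-V(x)u(x)\ge 0$ for every $x\in G$. *)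

theory Defs
  imports "HOL-Analysis.Analysis"
begin

text \<open>
  The vertex set \<open>G\<close> is an explicit carrier; edge weights, node measures and functions on the graph
  are total functions on the ambient type of which only the values on \<open>G\<close> matter.
\<close>

locale weighted_graph =
  fixes G :: "'a set" and \<omega> :: "'a \<Rightarrow> 'a \<Rightarrow> real" and \<mu> :: "'a \<Rightarrow> real"
  assumes countable_vertices: "countable G"
    and infinite_vertices: "infinite G"
    and measure_pos: "x \<in> G \<Longrightarrow> 0 < \<mu> x"
    and weight_nonneg: "x \<in> G \<Longrightarrow> y \<in> G \<Longrightarrow> 0 \<le> \<omega> x y"
    and weight_sym: "x \<in> G \<Longrightarrow> y \<in> G \<Longrightarrow> \<omega> x y = \<omega> y x"
    and weight_diag: "x \<in> G \<Longrightarrow> \<omega> x x = 0"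
    and weight_summable: "x \<in> G \<Longrightarrow> (\<lambda>y. \<omega> x y) summable_on G"

definition adjacent :: "('a \<Rightarrow> 'a \<Rightarrow> real) \<Rightarrow> 'a \<Rightarrow> 'a \<Rightarrow> bool" where
  "adjacent \<omega> x y \<longleftrightarrow> \<omega> x y > 0"

text \<open>A path is the nonempty list of its vertices, so it has \<open>length p - 1\<close> edges.\<close>

definition is_path :: "'a set \<Rightarrow> ('a \<Rightarrow> 'a \<Rightarrow> real) \<Rightarrow> 'a list \<Rightarrow> bool" where
  "is_path G \<omega> p \<longleftrightarrow> p \<noteq> [] \<and> set p \<subseteq> G \<and> successively (adjacent \<omega>) p"

definition joins :: "'a set \<Rightarrow> ('a \<Rightarrow> 'a \<Rightarrow> real) \<Rightarrow> 'a list \<Rightarrow> 'a \<Rightarrow> 'a \<Rightarrow> bool" where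
  "joins G \<omega> p x y \<longleftrightarrow> is_path G \<omega> p \<and> hd p = x \<and> last p = y"

definition connected_graph :: "'a set \<Rightarrow> ('a \<Rightarrow> 'a \<Rightarrow> real) \<Rightarrow> bool" where
  "connected_graph G \<omega> \<longleftrightarrow> (\<forall>x\<in>G. \<forall>y\<in>G. x \<noteq> y \<longrightarrow> (\<exists>p. joins G \<omega> p x y))"

definition locally_finite_graph :: "'a set \<Rightarrow> ('a \<Rightarrow> 'a \<Rightarrow> real) \<Rightarrow> bool" where
  "locally_finite_graph G \<omega> \<longleftrightarrow> (\<forall>x\<in>G. finite {y \<in> G. adjacent \<omega> x y})"

text \<open>
  As a \<open>LEAST\<close> on the naturals, this is meaningful only for vertices joined by a path.
\<close>

definition comb_dist :: "'a set \<Rightarrow> ('a \<Rightarrow> 'a \<Rightarrow> real) \<Rightarrow> 'a \<Rightarrow> 'a \<Rightarrow> nat" where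
  "comb_dist G \<omega> x y = (LEAST n. \<exists>p. joins G \<omega> p x y \<and> length p = Suc n)"

text \<open>On the naturals the infimum of a nonempty set is its minimum.\<close>

definition set_dist :: "'a set \<Rightarrow> ('a \<Rightarrow> 'a \<Rightarrow> real) \<Rightarrow> 'a set \<Rightarrow> 'a \<Rightarrow> nat" where
  "set_dist G \<omega> \<Omega> x = (INF y\<in>\<Omega>. comb_dist G \<omega> x y)"

definition dist_sphere :: "'a set \<Rightarrow> ('a \<Rightarrow> 'a \<Rightarrow> real) \<Rightarrow> 'a set \<Rightarrow> nat \<Rightarrow> 'a set" where
  "dist_sphere G \<omega> \<Omega> r = {x \<in> G. set_dist G \<omega> \<Omega> x = r}"

definition outer_degree ::
    "'a set \<Rightarrow> ('a \<Rightarrow> 'a \<Rightarrow> real) \<Rightarrow> ('a \<Rightarrow> real) \<Rightarrow> 'a set \<Rightarrow> 'a \<Rightarrow> real" where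
  "outer_degree G \<omega> \<mu> \<Omega> x =
     1 / \<mu> x * (\<Sum>\<^sub>\<infinity>y\<in>dist_sphere G \<omega> \<Omega> (set_dist G \<omega> \<Omega> x + 1). \<omega> x y)"

definition graph_laplacian ::
    "'a set \<Rightarrow> ('a \<Rightarrow> 'a \<Rightarrow> real) \<Rightarrow> ('a \<Rightarrow> real) \<Rightarrow> ('a \<Rightarrow> real) \<Rightarrow> 'a \<Rightarrow> real" where
  "graph_laplacian G \<omega> \<mu> f x = 1 / \<mu> x * (\<Sum>\<^sub>\<infinity>y\<in>G. (f y - f x) * \<omega> x y)"

definition subsolution ::
    "'a set \<Rightarrow> ('a \<Rightarrow> 'a \<Rightarrow> real) \<Rightarrow> ('a \<Rightarrow> real) \<Rightarrow> ('a \<Rightarrow> real) \<Rightarrow> ('a \<Rightarrow> real) \<Rightarrow> bool" where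
  "subsolution G \<omega> \<mu> V u \<longleftrightarrow> (\<forall>x\<in>G. graph_laplacian G \<omega> \<mu> u x - V x * u x \<ge> 0)"

text \<open>
  Only the values at vertices at distance greater than \<open>1\<close> from \<open>\<Omega>\<close> are meaningful.
\<close>

definition Z_tilde ::
    "'a set \<Rightarrow> ('a \<Rightarrow> 'a \<Rightarrow> real) \<Rightarrow> 'a set \<Rightarrow> real \<Rightarrow> 'a \<Rightarrow> real" where
  "Z_tilde G \<omega> \<Omega> \<alpha> x =
     (if \<alpha> < 1 then - (real (set_dist G \<omega> \<Omega> x) powr (1 - \<alpha>))
      else - ln (real (set_dist G \<omega> \<Omega> x)))"

text \<open>The filter of the limit \<open>\<rho>(x, \<Omega>) \<rightarrow> \<infinity>\<close> with \<open>x\<close> ranging over \<open>G\<close>.\<close>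

definition dist_at_infinity ::
    "'a set \<Rightarrow> ('a \<Rightarrow> 'a \<Rightarrow> real) \<Rightarrow> 'a set \<Rightarrow> 'a filter" where
  "dist_at_infinity G \<omega> \<Omega> = inf (filtercomap (set_dist G \<omega> \<Omega>) at_top) (principal G)"

end

theory Submission
  imports Defs
begin

text \<open>
  The proof is a comparison with a radial barrier \<open>w(x) = K + (\<Sum>j = 1..\<rho>(x, \<Omega>). j powr (-\<alpha>))\<close>.
  Neighbours of a vertex at distance \<open>r\<close> from \<open>\<Omega>\<close> are at distance at most \<open>r + 1\<close>, and since
  \<open>w\<close> is nondecreasing in the distance only the neighbours at distance exactly \<open>r + 1\<close>
  contribute positively to \<open>\<Delta>w\<close>.  Each of them contributes the increment
  \<open>(r + 1) powr (-\<alpha>)\<close>, so \<open>\<Delta>w(x) \<le> D\<^sub>+(x) * (r + 1) powr (-\<alpha>)\<close>.  This is the very power in the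
  lower bound of \<open>V\<close>, so \<open>\<Delta>w \<le> V w\<close> holds on all of \<open>G\<close> as soon as \<open>c\<^sub>0 * K\<close> bounds the outer
  degree everywhere; the vertices of \<open>\<Omega>\<close> itself, where the outer degree may exceed \<open>k\<^sub>0\<close>,
  are harmless because \<open>\<Omega>\<close> is finite.

  The partial sums dominate \<open>r powr (1 - \<alpha>)\<close>, and \<open>ln r\<close> if \<open>\<alpha> = 1\<close>.  Hence the growth condition
  gives, for every \<open>\<epsilon> > 0\<close>, that \<open>u \<le> \<epsilon> w\<close> far away from \<open>\<Omega>\<close>, that is, outside a finite set, balls
  being finite by local finiteness.  The subsolution \<open>u - \<epsilon> w\<close> can therefore only be
  positive somewhere if it has a positive maximum, at which \<open>\<Delta>(u - \<epsilon> w) \<le> 0 < V (u - \<epsilon> w)\<close>, a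
  contradiction.  So \<open>u \<le> \<epsilon> w\<close> on \<open>G\<close>, and \<open>\<epsilon> \<rightarrow> 0\<close> gives \<open>u \<le> 0\<close>.
\<close>

section \<open>The distance to a set of vertices\<close>

context weighted_graph
begin

lemma adjacent_sym: "x \<in> G \<Longrightarrow> y \<in> G \<Longrightarrow> adjacent \<omega> x y \<Longrightarrow> adjacent \<omega> y x"
  by (simp add: adjacent_def weight_sym)

lemma connected_joins:
  assumes "connected_graph G \<omega>" "x \<in> G" "y \<in> G"
  shows "\<exists>p. joins G \<omega> p x y"
proof (cases "x = y")
  case True
  then have "joins G \<omega> [x] x y"
    using assms by (simp add: joins_def is_path_def)
  then show ?thesis ..
next
  case False
  then show ?thesis
    using assms by (simp add: connected_graph_def)
qed

lemma comb_dist_le: "joins G \<omega> p x y \<Longrightarrow> length p = Suc n \<Longrightarrow> comb_dist G \<omega> x y \<le> n"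
  unfolding comb_dist_def by (rule Least_le) blast

lemma shortest_path:
  assumes "connected_graph G \<omega>" "x \<in> G" "y \<in> G"
  obtains p where "joins G \<omega> p x y" "length p = Suc (comb_dist G \<omega> x y)"
proof -
  obtain p where p: "joins G \<omega> p x y"
    using connected_joins[OF assms] by blast
  then have "length p = Suc (length p - 1)"
    by (simp add: joins_def is_path_def)
  with p have "\<exists>n p. joins G \<omega> p x y \<and> length p = Suc n"
    by blast
  then have "\<exists>p. joins G \<omega> p x y \<and> length p = Suc (comb_dist G \<omega> x y)"
    unfolding comb_dist_def by (rule LeastI_ex)
  with that show ?thesis by blast
qed

lemma comb_dist_adjacent_le:
  assumes "connected_graph G \<omega>" "x \<in> G" "y \<in> G" "z \<in> G" "adjacent \<omega> y x"
  shows "comb_dist G \<omega> y z \<le> comb_dist G \<omega> x z + 1"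
proof -
  obtain p where p: "joins G \<omega> p x z" "length p = Suc (comb_dist G \<omega> x z)"
    using shortest_path[OF assms(1,2,4)] .
  then have "joins G \<omega> (y # p) y z"
    using assms by (auto simp: joins_def is_path_def successively_Cons)
  from comb_dist_le[OF this, of "Suc (comb_dist G \<omega> x z)"] p show ?thesis
    by simp
qed

lemma comb_dist_descent:
  assumes "connected_graph G \<omega>" "x \<in> G" "z \<in> G" "comb_dist G \<omega> x z = Suc n"
  obtains y where "y \<in> G" "adjacent \<omega> x y" "comb_dist G \<omega> y z \<le> n"
proof -
  obtain p where p: "joins G \<omega> p x z" "length p = Suc (Suc n)"
    using shortest_path[OF assms(1-3)] assms(4) by auto
  then obtain y q where "p = x # y # q"
    by (cases p; cases "tl p") (auto simp: joins_def)
  with p have "joins G \<omega> (y # q) y z" "y \<in> G" "adjacent \<omega> x y" "length (y # q) = Suc n"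
    by (auto simp: joins_def is_path_def)
  with comb_dist_le that show ?thesis by blast
qed

lemma set_dist_le: "z \<in> \<Omega> \<Longrightarrow> set_dist G \<omega> \<Omega> x \<le> comb_dist G \<omega> x z"
  unfolding set_dist_def by (rule cINF_lower) auto

lemma nearest_point:
  assumes "\<Omega> \<noteq> {}"
  obtains z where "z \<in> \<Omega>" "set_dist G \<omega> \<Omega> x = comb_dist G \<omega> x z"
proof -
  have "set_dist G \<omega> \<Omega> x \<in> comb_dist G \<omega> x ` \<Omega>"
    unfolding set_dist_def using assms by (intro Inf_nat_def1) auto
  with that show ?thesis by blast
qed

lemma set_dist_adjacent_le:
  assumes "connected_graph G \<omega>" "\<Omega> \<subseteq> G" "\<Omega> \<noteq> {}" "x \<in> G" "y \<in> G" "adjacent \<omega> x y"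
  shows "set_dist G \<omega> \<Omega> y \<le> set_dist G \<omega> \<Omega> x + 1"
proof -
  obtain z where z: "z \<in> \<Omega>" "set_dist G \<omega> \<Omega> x = comb_dist G \<omega> x z"
    using nearest_point[OF assms(3)] .
  have "comb_dist G \<omega> y z \<le> comb_dist G \<omega> x z + 1"
    using comb_dist_adjacent_le[OF assms(1,4,5) _ adjacent_sym[OF assms(4-6)]] assms(2) z by auto
  with set_dist_le[OF z(1), of y] z show ?thesis by simp
qed

lemma set_dist_eq_0_imp_mem:
  assumes "connected_graph G \<omega>" "\<Omega> \<subseteq> G" "\<Omega> \<noteq> {}" "x \<in> G" "set_dist G \<omega> \<Omega> x = 0"
  shows "x \<in> \<Omega>"
proof -
  obtain z where z: "z \<in> \<Omega>" "comb_dist G \<omega> x z = 0"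
    using nearest_point[OF assms(3), of x] assms(5) by auto
  then have "z \<in> G"
    using assms(2) by auto
  from shortest_path[OF assms(1,4) this] z(2)
  obtain p where "joins G \<omega> p x z" "length p = Suc 0"
    by auto
  then have "x = z"
    by (cases p) (auto simp: joins_def)
  with z show ?thesis by simp
qed

text \<open>
  A vertex of the ball of radius \<open>n + 1\<close> that is not in the ball of radius \<open>n\<close> is adjacent to a
  vertex of the latter, namely to the next one on a shortest path to \<open>\<Omega>\<close>.  So local
  finiteness lets balls grow only by finitely many vertices at each step.
\<close>

lemma finite_ball:
  assumes "connected_graph G \<omega>" "locally_finite_graph G \<omega>" "\<Omega> \<subseteq> G" "\<Omega> \<noteq> {}" "finite \<Omega>"
  shows "finite {x \<in> G. set_dist G \<omega> \<Omega> x \<le> n}"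
proof (induction n)
  case 0
  have "{x \<in> G. set_dist G \<omega> \<Omega> x \<le> 0} \<subseteq> \<Omega>"
    using set_dist_eq_0_imp_mem[OF assms(1,3,4)] by auto
  then show ?case using assms(5) by (rule finite_subset)
next
  case (Suc n)
  let ?B = "{x \<in> G. set_dist G \<omega> \<Omega> x \<le> n}"
  have "{x \<in> G. set_dist G \<omega> \<Omega> x \<le> Suc n} \<subseteq> ?B \<union> (\<Union>y\<in>?B. {x \<in> G. adjacent \<omega> y x})"
  proof
    fix x assume "x \<in> {x \<in> G. set_dist G \<omega> \<Omega> x \<le> Suc n}"
    then have x: "x \<in> G" "set_dist G \<omega> \<Omega> x \<le> Suc n" by auto
    show "x \<in> ?B \<union> (\<Union>y\<in>?B. {x \<in> G. adjacent \<omega> y x})"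
    proof (cases "set_dist G \<omega> \<Omega> x \<le> n")
      case False
      obtain z where z: "z \<in> \<Omega>" "set_dist G \<omega> \<Omega> x = comb_dist G \<omega> x z"
        using nearest_point[OF assms(4)] .
      then have "comb_dist G \<omega> x z = Suc n" "z \<in> G"
        using x False assms(3) by auto
      from comb_dist_descent[OF assms(1) x(1) this(2,1)]
      obtain y where "y \<in> G" "adjacent \<omega> x y" "comb_dist G \<omega> y z \<le> n" .
      moreover from this have "set_dist G \<omega> \<Omega> y \<le> n"
        using set_dist_le[OF z(1), of y] by simp
      ultimately show ?thesis
        using x adjacent_sym by blast
    qed (use x in auto)
  qed
  moreover have "finite (\<Union>y\<in>?B. {x \<in> G. adjacent \<omega> y x})"
    using Suc.IH assms(2) by (auto simp: locally_finite_graph_def)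
  ultimately show ?case
    using Suc.IH by (meson finite_UnI finite_subset)
qed

section \<open>The Laplace operator of a locally finite graph\<close>

lemma infsum_weight_eq_sum:
  assumes "locally_finite_graph G \<omega>" "x \<in> G" "A \<subseteq> G"
  shows "(\<Sum>\<^sub>\<infinity>y\<in>A. f y * \<omega> x y) = (\<Sum>y | y \<in> A \<and> adjacent \<omega> x y. f y * \<omega> x y)"
proof -
  have "finite {y \<in> A. adjacent \<omega> x y}"
    using assms finite_subset[of "{y \<in> A. adjacent \<omega> x y}" "{y \<in> G. adjacent \<omega> x y}"]
    by (auto simp: locally_finite_graph_def)
  moreover have "\<omega> x y = 0" if "y \<in> A" "\<not> adjacent \<omega> x y" for y
    using that assms weight_nonneg[of x y] by (auto simp: adjacent_def)
  then have "(\<Sum>\<^sub>\<infinity>y\<in>A. f y * \<omega> x y) = (\<Sum>\<^sub>\<infinity>y\<in>{y \<in> A. adjacent \<omega> x y}. f y * \<omega> x y)"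
    by (intro infsum_cong_neutral) auto
  ultimately show ?thesis by simp
qed

lemma graph_laplacian_eq_sum:
  assumes "locally_finite_graph G \<omega>" "x \<in> G"
  shows "graph_laplacian G \<omega> \<mu> f x =
    1 / \<mu> x * (\<Sum>y | y \<in> G \<and> adjacent \<omega> x y. (f y - f x) * \<omega> x y)"
  unfolding graph_laplacian_def using infsum_weight_eq_sum[OF assms, of G] by simp

lemma graph_laplacian_diff_scale:
  assumes "locally_finite_graph G \<omega>" "x \<in> G"
  shows "graph_laplacian G \<omega> \<mu> (\<lambda>y. f y - c * g y) x =
    graph_laplacian G \<omega> \<mu> f x - c * graph_laplacian G \<omega> \<mu> g x"
  unfolding graph_laplacian_eq_sum[OF assms]
  by (simp add: algebra_simps sum_subtractf sum.distrib sum_distrib_left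
      diff_divide_distrib add_divide_distrib)

text \<open>
  For a radial function \<open>h \<circ> \<rho>\<close> with \<open>h\<close> nondecreasing, edges staying on the sphere contribute
  nothing to the Laplacian and edges leading inwards contribute nonpositively.  Every
  remaining edge leads outwards by exactly one step and contributes the same increment of \<open>h\<close>.
\<close>

lemma graph_laplacian_radial_le:
  assumes "connected_graph G \<omega>" "locally_finite_graph G \<omega>" "\<Omega> \<subseteq> G" "\<Omega> \<noteq> {}" "x \<in> G" "mono h"
  shows "graph_laplacian G \<omega> \<mu> (\<lambda>y. h (set_dist G \<omega> \<Omega> y)) x \<le>
    outer_degree G \<omega> \<mu> \<Omega> x * (h (set_dist G \<omega> \<Omega> x + 1) - h (set_dist G \<omega> \<Omega> x))"
proof -
  let ?\<rho> = "set_dist G \<omega> \<Omega>"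
  let ?N = "{y \<in> G. adjacent \<omega> x y}"
  let ?S = "dist_sphere G \<omega> \<Omega> (?\<rho> x + 1)"
  let ?d = "h (?\<rho> x + 1) - h (?\<rho> x)"
  have fin: "finite ?N"
    using assms by (auto simp: locally_finite_graph_def)
  have S: "{y \<in> ?S. adjacent \<omega> x y} = ?N \<inter> ?S" "?S \<subseteq> G"
    by (auto simp: dist_sphere_def)
  have "(\<Sum>y\<in>?N. (h (?\<rho> y) - h (?\<rho> x)) * \<omega> x y) \<le> (\<Sum>y\<in>?N. if y \<in> ?S then ?d * \<omega> x y else 0)"
  proof (rule sum_mono)
    fix y assume "y \<in> ?N"
    then have y: "y \<in> G" "adjacent \<omega> x y" "0 < \<omega> x y"
      by (auto simp: adjacent_def)
    show "(h (?\<rho> y) - h (?\<rho> x)) * \<omega> x y \<le> (if y \<in> ?S then ?d * \<omega> x y else 0)"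
    proof (cases "y \<in> ?S")
      case False
      then have "?\<rho> y \<le> ?\<rho> x"
        using set_dist_adjacent_le[OF assms(1,3,4,5) y(1,2)] y by (auto simp: dist_sphere_def)
      then show ?thesis
        using False y monoD[OF assms(6)] by (simp add: mult_nonpos_nonneg)
    qed (simp add: dist_sphere_def)
  qed
  also have "\<dots> = ?d * (\<Sum>y\<in>?N \<inter> ?S. \<omega> x y)"
    using fin by (simp add: sum.inter_restrict sum_distrib_left if_distrib cong: if_cong)
  also have "(\<Sum>y\<in>?N \<inter> ?S. \<omega> x y) = (\<Sum>\<^sub>\<infinity>y\<in>?S. \<omega> x y)"
    using infsum_weight_eq_sum[OF assms(2,5) S(2), of "\<lambda>_. 1"] S(1) by simp
  finally show ?thesis
    using measure_pos[OF assms(5)] graph_laplacian_eq_sum[OF assms(2,5)]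
    by (simp add: outer_degree_def divide_right_mono mult.commute)
qed

text \<open>
  A positive value would make the maximum over the finite set where \<open>v\<close> is positive a global
  maximum of \<open>v\<close>, and there the Laplacian is nonpositive.
\<close>

lemma maximum_principle:
  assumes "locally_finite_graph G \<omega>" and sub: "subsolution G \<omega> \<mu> V v"
    and V: "\<And>x. x \<in> G \<Longrightarrow> 0 < V x" and fin: "finite {x \<in> G. 0 < v x}" and x: "x \<in> G"
  shows "v x \<le> 0"
proof (rule ccontr)
  let ?P = "{x \<in> G. 0 < v x}"
  assume "\<not> v x \<le> 0"
  with x have ne: "?P \<noteq> {}" by auto
  obtain m where m: "m \<in> ?P" "v m = Max (v ` ?P)"
    using Max_in[of "v ` ?P"] fin ne by fastforce
  have max: "v y \<le> v m" if "y \<in> G" for y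
  proof (cases "0 < v y")
    case True
    with that fin m(2) show ?thesis by simp
  qed (use m in auto)
  have "(\<Sum>y | y \<in> G \<and> adjacent \<omega> m y. (v y - v m) * \<omega> m y) \<le> 0"
    using max m by (intro sum_nonpos mult_nonpos_nonneg) (auto simp: adjacent_def)
  then have "graph_laplacian G \<omega> \<mu> v m \<le> 0"
    using graph_laplacian_eq_sum[OF assms(1), of m v] measure_pos[of m] m
    by (simp add: divide_nonpos_pos)
  moreover have "0 < V m * v m"
    using V m by simp
  moreover have "0 \<le> graph_laplacian G \<omega> \<mu> v m - V m * v m"
    using sub m by (auto simp: subsolution_def)
  ultimately show False by simp
qed

text \<open>
  Since \<open>w\<close> is a supersolution, \<open>u - \<epsilon> w\<close> is a subsolution.  Finiteness of \<open>{u > \<epsilon> w}\<close>, which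
  holds if \<open>w\<close> outgrows the positive part of \<open>u\<close> at infinity, is what the maximum principle
  needs to give \<open>u \<le> \<epsilon> w\<close>; as \<open>\<epsilon>\<close> is arbitrary, \<open>w\<close> disappears from the conclusion.
\<close>

lemma comparison_principle:
  assumes "locally_finite_graph G \<omega>" and sub: "subsolution G \<omega> \<mu> V u"
    and V: "\<And>x. x \<in> G \<Longrightarrow> 0 < V x"
    and super: "\<And>x. x \<in> G \<Longrightarrow> graph_laplacian G \<omega> \<mu> w x \<le> V x * w x"
    and fin: "\<And>\<epsilon>. 0 < \<epsilon> \<Longrightarrow> finite {x \<in> G. \<epsilon> * w x < u x}" and x: "x \<in> G"
  shows "u x \<le> 0"
proof -
  have le: "u x \<le> \<epsilon> * w x" if "0 < \<epsilon>" for \<epsilon>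
  proof -
    let ?v = "\<lambda>y. u y - \<epsilon> * w y"
    have "0 \<le> graph_laplacian G \<omega> \<mu> ?v y - V y * ?v y" if "y \<in> G" for y
    proof -
      have "\<epsilon> * graph_laplacian G \<omega> \<mu> w y \<le> \<epsilon> * (V y * w y)"
        using super[OF that] \<open>0 < \<epsilon>\<close> by simp
      then show ?thesis
        using bspec[OF sub[unfolded subsolution_def] that]
        unfolding graph_laplacian_diff_scale[OF assms(1) that] by (simp add: algebra_simps)
    qed
    then have "subsolution G \<omega> \<mu> V ?v"
      by (simp add: subsolution_def)
    from maximum_principle[OF assms(1) this V _ x] fin[OF that] show ?thesis
      by simp
  qed
  have "((\<lambda>\<epsilon>. \<epsilon> * w x) \<longlongrightarrow> 0 * w x) (at_right 0)"
    by (intro tendsto_intros)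
  moreover have "eventually (\<lambda>\<epsilon>. u x \<le> \<epsilon> * w x) (at_right 0)"
    using eventually_at_right_less by (rule eventually_mono) (rule le)
  ultimately have "u x \<le> 0 * w x"
    by (rule tendsto_lowerbound) simp
  then show ?thesis by simp
qed

end

section \<open>The radial barrier\<close>

text \<open>
  Its increment at \<open>n\<close> is \<open>(n + 1) powr (-\<alpha>)\<close>, the power that bounds \<open>V\<close> from below at
  distance \<open>n\<close>.  This replaces both \<open>n powr (1 - \<alpha>)\<close> and, for \<open>\<alpha> = 1\<close>, \<open>ln n\<close>, whose increments
  would have to be estimated.
\<close>

definition power_sum :: "real \<Rightarrow> nat \<Rightarrow> real" where
  "power_sum \<alpha> n = (\<Sum>j = 1..n. real j powr (- \<alpha>))"

lemma power_sum_Suc: "power_sum \<alpha> (n + 1) = power_sum \<alpha> n + (1 + real n) powr (- \<alpha>)"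
  by (simp add: power_sum_def add.commute)

lemma mono_power_sum: "mono (power_sum \<alpha>)"
  unfolding mono_iff_le_Suc using power_sum_Suc[of \<alpha>] by simp

lemma power_sum_nonneg: "0 \<le> power_sum \<alpha> n"
  by (simp add: power_sum_def sum_nonneg)

lemma powr_le_power_sum:
  assumes "0 \<le> \<alpha>" "1 \<le> n"
  shows "real n powr (1 - \<alpha>) \<le> power_sum \<alpha> n"
proof -
  have "real n powr (1 - \<alpha>) = (\<Sum>j = 1..n. real n powr (- \<alpha>))"
    using assms powr_add[of "real n" 1 "- \<alpha>"] by simp
  also have "\<dots> \<le> power_sum \<alpha> n"
    unfolding power_sum_def using assms by (intro sum_mono powr_mono2') auto
  finally show ?thesis .
qed

lemma ln_le_power_sum:
  assumes "1 \<le> n"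
  shows "ln (real n) \<le> power_sum 1 n"
proof -
  have "ln (real n) \<le> ln (real n + 1)"
    using assms by simp
  also have "\<dots> \<le> harm n"
    by (rule ln_le_harm)
  also have "\<dots> = power_sum 1 n"
    unfolding harm_def power_sum_def by (intro sum.cong) (auto simp: powr_minus)
  finally show ?thesis .
qed

lemma abs_Z_tilde_le_power_sum:
  assumes "\<alpha> \<in> {0..1}" "2 \<le> set_dist G \<omega> \<Omega> x"
  shows "\<bar>Z_tilde G \<omega> \<Omega> \<alpha> x\<bar> \<le> power_sum \<alpha> (set_dist G \<omega> \<Omega> x)"
    and "0 < \<bar>Z_tilde G \<omega> \<Omega> \<alpha> x\<bar>"
  using assms powr_le_power_sum[of \<alpha> "set_dist G \<omega> \<Omega> x"] ln_le_power_sum[of "set_dist G \<omega> \<Omega> x"]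
  by (auto simp: Z_tilde_def)

section \<open>Nonpositivity of subsolutions\<close>

theorem theorem3p3:
  fixes G :: "'a set" and \<omega> :: "'a \<Rightarrow> 'a \<Rightarrow> real" and \<mu> :: "'a \<Rightarrow> real"
    and \<Omega> :: "'a set" and V u :: "'a \<Rightarrow> real" and k\<^sub>0 c\<^sub>0 \<alpha> :: real
  assumes graph: "weighted_graph G \<omega> \<mu>"
    and conn: "connected_graph G \<omega>"
    and loc_fin: "locally_finite_graph G \<omega>"
    and Omega: "\<Omega> \<subseteq> G" "\<Omega> \<noteq> {}" "finite \<Omega>"
    and k0: "k\<^sub>0 > 0"
    and outer: "\<forall>x\<in>G. set_dist G \<omega> \<Omega> x \<ge> 1 \<longrightarrow>
                  0 \<le> outer_degree G \<omega> \<mu> \<Omega> x \<and> outer_degree G \<omega> \<mu> \<Omega> x \<le> k\<^sub>0"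
    and alpha: "\<alpha> \<in> {0..1}"
    and c0: "c\<^sub>0 > 0"
    and V: "\<forall>x\<in>G. V x \<ge> c\<^sub>0 * (1 + real (set_dist G \<omega> \<Omega> x)) powr (- \<alpha>)"
    and sub: "subsolution G \<omega> \<mu> V u"
    and limsup: "Limsup (dist_at_infinity G \<omega> \<Omega>)
                   (\<lambda>x. ereal (u x / \<bar>Z_tilde G \<omega> \<Omega> \<alpha> x\<bar>)) \<le> 0"
  shows "\<forall>x\<in>G. u x \<le> 0"
proof -
  interpret weighted_graph G \<omega> \<mu> by (rule graph)
  let ?\<rho> = "set_dist G \<omega> \<Omega>"
  have "finite {x \<in> G. ?\<rho> x \<le> 0}"
    by (rule finite_ball[OF conn loc_fin Omega])
  \<comment> \<open>The hypothesis bounds the outer degree only off \<open>\<Omega>\<close>; its finitely many values on \<open>\<Omega>\<close>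
    are absorbed by their sum.\<close>
  define k where "k = k\<^sub>0 + (\<Sum>x\<in>{x \<in> G. ?\<rho> x \<le> 0}. \<bar>outer_degree G \<omega> \<mu> \<Omega> x\<bar>)"
  have degree_le: "outer_degree G \<omega> \<mu> \<Omega> x \<le> k" if "x \<in> G" for x
  proof (cases "?\<rho> x \<le> 0")
    case True
    then have "\<bar>outer_degree G \<omega> \<mu> \<Omega> x\<bar> \<le> (\<Sum>x\<in>{x \<in> G. ?\<rho> x \<le> 0}. \<bar>outer_degree G \<omega> \<mu> \<Omega> x\<bar>)"
      using that \<open>finite {x \<in> G. ?\<rho> x \<le> 0}\<close> by (intro member_le_sum) auto
    then show ?thesis
      using k0 by (simp add: k_def)
  next
    case False
    then have "outer_degree G \<omega> \<mu> \<Omega> x \<le> k\<^sub>0"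
      using outer that by simp
    then show ?thesis
      by (simp add: k_def add_increasing2 sum_nonneg)
  qed
  have "0 < k"
    using k0 by (simp add: k_def add_pos_nonneg sum_nonneg)
  define h where "h n = k / c\<^sub>0 + power_sum \<alpha> n" for n
  have V_pos: "0 < V x" if "x \<in> G" for x
  proof -
    have "0 < c\<^sub>0 * (1 + real (?\<rho> x)) powr (- \<alpha>)"
      using c0 by simp
    with V that show ?thesis by fastforce
  qed
  have super: "graph_laplacian G \<omega> \<mu> (\<lambda>y. h (?\<rho> y)) x \<le> V x * h (?\<rho> x)" if "x \<in> G" for x
  proof -
    let ?d = "(1 + real (?\<rho> x)) powr (- \<alpha>)"
    have "mono h"
      using mono_power_sum by (auto simp: h_def mono_def)
    then have "graph_laplacian G \<omega> \<mu> (\<lambda>y. h (?\<rho> y)) x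
        \<le> outer_degree G \<omega> \<mu> \<Omega> x * (h (?\<rho> x + 1) - h (?\<rho> x))"
      by (rule graph_laplacian_radial_le[OF conn loc_fin Omega(1,2) that])
    also have "h (?\<rho> x + 1) - h (?\<rho> x) = ?d"
      unfolding h_def power_sum_Suc by simp
    also have "outer_degree G \<omega> \<mu> \<Omega> x * ?d \<le> k * ?d"
      using degree_le[OF that] by (intro mult_right_mono) auto
    also have "\<dots> = (c\<^sub>0 * ?d) * (k / c\<^sub>0)"
      using c0 by simp
    also have "\<dots> \<le> V x * h (?\<rho> x)"
      using V that V_pos[OF that] c0 \<open>0 < k\<close> power_sum_nonneg[of \<alpha>]
      by (intro mult_mono) (auto simp: h_def)
    finally show ?thesis .
  qed
  have fin: "finite {x \<in> G. \<epsilon> * h (?\<rho> x) < u x}" if "0 < \<epsilon>" for \<epsilon>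
  proof -
    have "Limsup (dist_at_infinity G \<omega> \<Omega>) (\<lambda>x. ereal (u x / \<bar>Z_tilde G \<omega> \<Omega> \<alpha> x\<bar>)) < ereal \<epsilon>"
      using limsup that by (simp add: order_le_less_trans)
    then have "eventually (\<lambda>x. ereal (u x / \<bar>Z_tilde G \<omega> \<Omega> \<alpha> x\<bar>) < ereal \<epsilon>) (dist_at_infinity G \<omega> \<Omega>)"
      by (rule Limsup_lessD)
    then obtain N where N: "u x / \<bar>Z_tilde G \<omega> \<Omega> \<alpha> x\<bar> < \<epsilon>" if "N \<le> ?\<rho> x" "x \<in> G" for x
      by (auto simp: dist_at_infinity_def eventually_inf_principal eventually_filtercomap_at_top_linorder)
    \<comment> \<open>Staying beyond distance \<open>1\<close> avoids the zero of the logarithm.\<close>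
    have "?\<rho> x \<le> max N 2" if "x \<in> G" "\<epsilon> * h (?\<rho> x) < u x" for x
    proof (rule ccontr)
      assume "\<not> ?\<rho> x \<le> max N 2"
      then have far: "N \<le> ?\<rho> x" "2 \<le> ?\<rho> x" by auto
      have "u x \<le> \<epsilon> * \<bar>Z_tilde G \<omega> \<Omega> \<alpha> x\<bar>"
        using N[OF far(1) that(1)] abs_Z_tilde_le_power_sum(2)[OF alpha far(2)]
        by (simp add: pos_divide_less_eq)
      also have "\<dots> \<le> \<epsilon> * h (?\<rho> x)"
        using abs_Z_tilde_le_power_sum(1)[OF alpha far(2)] \<open>0 < \<epsilon>\<close> \<open>0 < k\<close> c0
        by (intro mult_left_mono) (auto simp: h_def add_increasing)
      finally show False using that(2) by simp
    qed
    then show ?thesis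
      using finite_ball[OF conn loc_fin Omega, of "max N 2"]
      by (auto intro: finite_subset[rotated])
  qed
  show ?thesis
    using comparison_principle[OF loc_fin sub V_pos super fin] by blast
qed

end
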